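(* Let $k_\mathcal{G}=k_\mathcal{H}=1$. Then the reduced Gröbner basis of $I_{\text{viz}}$ with respect to a total degree lexicographical term ordering consists of the polynomials $e_{g_1g}-1$ for all $g\in V(\mathcal{G})\setminus\{g_1\}$; $e_{h_1h}-1$ for all $h\in V(\mathcal{H})\setminus\{h_1\}$; $e_{gg'}(e_{gg'}-1)$ for all distinct $g,g'\in V(\mathcal{G})\setminus\{g_1\}$; $e_{hh'}(e_{hh'}-1)$ for all distinct $h,h'\in V(\mathcal{H})\setminus\{h_1\}$; $x_{gh}(x_{gh}-1)$ for all $(g,h)\in V(\mathcal{G}\square\mathcal{H})$; and $$b_{gh,M}=\prod_{(g',h')\in\overline{U}_{gh}}(x_{g'h'}-1)\prod_{(g,h')\in U^r_{gh}}\big([(g,h')\in M](x_{gh'}-e_{hh'})+e_{hh'}-1\big)\prod_{(g',h)\in U^c_{gh}}\big([(g',h)\in M](x_{g'h}-e_{gg'})+e_{gg'}-1\big)$$ for all subsets $M\subseteq U_{gh}$ and all $(g,h)\in V(\mathcal{G}\square\mathcal{H})$.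
   Context: Let $\mathbb{K}\subseteq\mathbb{R}$ be a field and $n_\mathcal{G},n_\mathcal{H}$ positive integers. Let $V(\mathcal{G})=\{g_1,\dots,g_{n_\mathcal{G}}\}$, $V(\mathcal{H})=\{h_1,\dots,h_{n_\mathcal{H}}\}$, $V(\mathcal{G}\square\mathcal{H})=V(\mathcal{G})\times V(\mathcal{H})$. Introduce an edge variable $e_{gg'}=e_{g'g}$ for every unordered pair of distinct $g,g'\in V(\mathcal{G})$, an edge variable $e_{hh'}=e_{h'h}$ for every unordered pair of distinct $h,h'\in V(\mathcal{H})$, and a vertex variable $x_{gh}$ for every $(g,h)\in V(\mathcal{G}\square\mathcal{H})$; let $P$ be the polynomial ring over $\mathbb{K}$ in all these variables. For $k_\mathcal{G}=k_\mathcal{H}=1$ (minimum dominating sets $\{g_1\}$ and $\{h_1\}$) the Vizing ideal $I_{\text{viz}}\subseteq P$ is the ideal generated by: $e_{gg'}(e_{gg'}-1)$ for all distinct $g,g'\in V(\mathcal{G})$; $1-e_{gg_1}$ for all $g\in V(\mathcal{G})\setminus\{g_1\}$; $e_{hh'}(e_{hh'}-1)$ for all distinct $h,h'\in V(\mathcal{H})$; $1-e_{hh_1}$ for all $h\in V(\mathcal{H})\setminus\{h_1\}$; and, for all $g\in V(\mathcal{G})$, $h\in V(\mathcal{H})$, the polynomials $x_{gh}(x_{gh}-1)$ and $(1-x_{gh})\prod_{g'\ne g}(1-e_{gg'}x_{g'h})\prod_{h'\neq h}(1-e_{hh'}x_{gh'})$. For $(g,h)\in V(\mathcal{G}\square\mathcal{H})$: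 $T_{gh}=\{(g',h') : g'=g\text{ or }h'=h\}$; $U^r_{gh}=\{(g,h') : h'\notin\{h_1,h\}\}$ if $h\ne h_1$ and $U^r_{gh}=\emptyset$ if $h=h_1$; $U^c_{gh}=\{(g',h) : g'\notin\{g_1,g\}\}$ if $g\neq g_1$ and $U^c_{gh}=\emptyset$ if $g=g_1$; $U_{gh}=U^r_{gh}\cup U^c_{gh}$; $\overline{U}_{gh}=T_{gh}\setminus U_{gh}$. For a statement $A$, $[A]$ equals $1$ if $A$ is true and $0$ otherwise.
   Formalization: The case where both graphs have exactly one vertex is excluded: there the listed set is {x(x-1), x-1} (with x the single vertex variable), which is a Gröbner basis but not reduced, since x divides x². *)

theory Defs
  imports Complex_Main "HOL-Library.Poly_Mapping"
begin

section \<open>Polynomials over a subfield of the reals\<close>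

type_synonym 'v monom = "'v \<Rightarrow>\<^sub>0 nat"
type_synonym 'v rpoly = "('v \<Rightarrow>\<^sub>0 nat) \<Rightarrow>\<^sub>0 real"

definition real_subfield :: "real set \<Rightarrow> bool" where
  "real_subfield K \<longleftrightarrow>
     0 \<in> K \<and> 1 \<in> K \<and>
     (\<forall>a\<in>K. \<forall>b\<in>K. a + b \<in> K \<and> a - b \<in> K \<and> a * b \<in> K) \<and>
     (\<forall>a\<in>K. a \<noteq> 0 \<longrightarrow> inverse a \<in> K)"

definition poly_ring :: "real set \<Rightarrow> 'v set \<Rightarrow> 'v rpoly set" where
  "poly_ring K V =
     {p. (\<forall>t. Poly_Mapping.lookup p t \<in> K) \<and>
         (\<forall>t \<in> Poly_Mapping.keys p. Poly_Mapping.keys t \<subseteq> V)}"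

definition pvar :: "'v \<Rightarrow> 'v rpoly" where
  "pvar v = Poly_Mapping.single (Poly_Mapping.single v 1) 1"

text \<open>The ideal of the ring with carrier \<open>R\<close> generated by \<open>S\<close>.\<close>

definition ideal_gen :: "'v rpoly set \<Rightarrow> 'v rpoly set \<Rightarrow> 'v rpoly set" where
  "ideal_gen R S = {\<Sum>f\<in>F. q f * f | F q. finite F \<and> F \<subseteq> S \<and> (\<forall>f\<in>F. q f \<in> R)}"


section \<open>Term orderings and Groebner bases\<close>

definition mon_deg :: "'v monom \<Rightarrow> nat" where
  "mon_deg t = (\<Sum>v\<in>Poly_Mapping.keys t. Poly_Mapping.lookup t v)"

text \<open>Strict total degree lexicographical ordering on monomials. The relation \<open>r\<close> is a
  (reflexive) linear order of the variables; ties in the degree are broken at the \<open>r\<close>-largest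
  variable whose exponents differ.\<close>

definition deglex :: "'v rel \<Rightarrow> 'v monom \<Rightarrow> 'v monom \<Rightarrow> bool" where
  "deglex r s t \<longleftrightarrow>
     mon_deg s < mon_deg t \<or>
     mon_deg s = mon_deg t \<and>
       (\<exists>v. Poly_Mapping.lookup s v < Poly_Mapping.lookup t v \<and>
         (\<forall>u. (v, u) \<in> r \<and> u \<noteq> v \<longrightarrow>
            Poly_Mapping.lookup s u = Poly_Mapping.lookup t u))"

text \<open>In the following, \<open>ord\<close> is a strict term ordering. For \<open>p = 0\<close> the leading monomial is
  unspecified, but the leading coefficient and the leading term are \<open>0\<close>.\<close>

definition lead_monom :: "('v monom \<Rightarrow> 'v monom \<Rightarrow> bool) \<Rightarrow> 'v rpoly \<Rightarrow> 'v monom" where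
  "lead_monom ord p =
     (THE t. t \<in> Poly_Mapping.keys p \<and> (\<forall>s \<in> Poly_Mapping.keys p. s \<noteq> t \<longrightarrow> ord s t))"

definition lead_coef :: "('v monom \<Rightarrow> 'v monom \<Rightarrow> bool) \<Rightarrow> 'v rpoly \<Rightarrow> real" where
  "lead_coef ord p = Poly_Mapping.lookup p (lead_monom ord p)"

definition lead_term :: "('v monom \<Rightarrow> 'v monom \<Rightarrow> bool) \<Rightarrow> 'v rpoly \<Rightarrow> 'v rpoly" where
  "lead_term ord p = Poly_Mapping.single (lead_monom ord p) (lead_coef ord p)"

definition is_groebner_basis ::
  "('v monom \<Rightarrow> 'v monom \<Rightarrow> bool) \<Rightarrow> 'v rpoly set \<Rightarrow> 'v rpoly set \<Rightarrow> 'v rpoly set \<Rightarrow> bool" where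
  "is_groebner_basis ord R I G \<longleftrightarrow>
     finite G \<and> G \<subseteq> I \<and>
     ideal_gen R (lead_term ord ` G) = ideal_gen R (lead_term ord ` (I - {0}))"

definition is_reduced_groebner_basis ::
  "('v monom \<Rightarrow> 'v monom \<Rightarrow> bool) \<Rightarrow> 'v rpoly set \<Rightarrow> 'v rpoly set \<Rightarrow> 'v rpoly set \<Rightarrow> bool" where
  "is_reduced_groebner_basis ord R I G \<longleftrightarrow>
     is_groebner_basis ord R I G \<and>
     (\<forall>p\<in>G. lead_coef ord p = 1) \<and>
     (\<forall>p\<in>G. \<forall>t\<in>Poly_Mapping.keys p.
        Poly_Mapping.single t 1 \<notin> ideal_gen R (lead_term ord ` (G - {p})))"


section \<open>The Vizing ideal for domination numbers one\<close>

text \<open>The vertices \<open>g\<^sub>i\<close> and \<open>h\<^sub>j\<close> are represented by their indices in \<open>{1..nG}\<close> and \<open>{1..nH}\<close>.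
  Edge variables are indexed by two-element sets of vertices, so that \<open>e\<^sub>g\<^sub>g\<^sub>' = e\<^sub>g\<^sub>'\<^sub>g\<close>.\<close>

datatype viz_var = EdgeG "nat set" | EdgeH "nat set" | Vert nat nat

definition viz_vars :: "nat \<Rightarrow> nat \<Rightarrow> viz_var set" where
  "viz_vars nG nH =
     {EdgeG {g, g'} | g g'. g \<in> {1..nG} \<and> g' \<in> {1..nG} \<and> g \<noteq> g'} \<union>
     {EdgeH {h, h'} | h h'. h \<in> {1..nH} \<and> h' \<in> {1..nH} \<and> h \<noteq> h'} \<union>
     {Vert g h | g h. g \<in> {1..nG} \<and> h \<in> {1..nH}}"

definition eG :: "nat \<Rightarrow> nat \<Rightarrow> viz_var rpoly" where
  "eG g g' = pvar (EdgeG {g, g'})"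

definition eH :: "nat \<Rightarrow> nat \<Rightarrow> viz_var rpoly" where
  "eH h h' = pvar (EdgeH {h, h'})"

definition xv :: "nat \<Rightarrow> nat \<Rightarrow> viz_var rpoly" where
  "xv g h = pvar (Vert g h)"

definition viz_ring :: "real set \<Rightarrow> nat \<Rightarrow> nat \<Rightarrow> viz_var rpoly set" where
  "viz_ring K nG nH = poly_ring K (viz_vars nG nH)"

definition viz_gens :: "nat \<Rightarrow> nat \<Rightarrow> viz_var rpoly set" where
  "viz_gens nG nH =
     {eG g g' * (eG g g' - 1) | g g'. g \<in> {1..nG} \<and> g' \<in> {1..nG} \<and> g \<noteq> g'} \<union>
     {1 - eG g 1 | g. g \<in> {1..nG} - {1}} \<union>
     {eH h h' * (eH h h' - 1) | h h'. h \<in> {1..nH} \<and> h' \<in> {1..nH} \<and> h \<noteq> h'} \<union>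
     {1 - eH h 1 | h. h \<in> {1..nH} - {1}} \<union>
     {xv g h * (xv g h - 1) | g h. g \<in> {1..nG} \<and> h \<in> {1..nH}} \<union>
     {(1 - xv g h) * (\<Prod>g'\<in>{1..nG} - {g}. 1 - eG g g' * xv g' h)
                   * (\<Prod>h'\<in>{1..nH} - {h}. 1 - eH h h' * xv g h')
        | g h. g \<in> {1..nG} \<and> h \<in> {1..nH}}"

definition viz_ideal :: "real set \<Rightarrow> nat \<Rightarrow> nat \<Rightarrow> viz_var rpoly set" where
  "viz_ideal K nG nH = ideal_gen (viz_ring K nG nH) (viz_gens nG nH)"


section \<open>The claimed reduced Groebner basis\<close>

definition T_set :: "nat \<Rightarrow> nat \<Rightarrow> nat \<Rightarrow> nat \<Rightarrow> (nat \<times> nat) set" where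
  "T_set nG nH g h = {(g', h'). g' \<in> {1..nG} \<and> h' \<in> {1..nH} \<and> (g' = g \<or> h' = h)}"

definition Ur_set :: "nat \<Rightarrow> nat \<Rightarrow> nat \<Rightarrow> (nat \<times> nat) set" where
  "Ur_set nH g h = (if h \<noteq> 1 then {(g, h') | h'. h' \<in> {1..nH} \<and> h' \<notin> {1, h}} else {})"

definition Uc_set :: "nat \<Rightarrow> nat \<Rightarrow> nat \<Rightarrow> (nat \<times> nat) set" where
  "Uc_set nG g h = (if g \<noteq> 1 then {(g', h) | g'. g' \<in> {1..nG} \<and> g' \<notin> {1, g}} else {})"

definition U_set :: "nat \<Rightarrow> nat \<Rightarrow> nat \<Rightarrow> nat \<Rightarrow> (nat \<times> nat) set" where
  "U_set nG nH g h = Ur_set nH g h \<union> Uc_set nG g h"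

definition Ubar_set :: "nat \<Rightarrow> nat \<Rightarrow> nat \<Rightarrow> nat \<Rightarrow> (nat \<times> nat) set" where
  "Ubar_set nG nH g h = T_set nG nH g h - U_set nG nH g h"

definition b_poly :: "nat \<Rightarrow> nat \<Rightarrow> nat \<Rightarrow> nat \<Rightarrow> (nat \<times> nat) set \<Rightarrow> viz_var rpoly" where
  "b_poly nG nH g h M =
     (\<Prod>(g', h')\<in>Ubar_set nG nH g h. xv g' h' - 1) *
     (\<Prod>(_, h')\<in>Ur_set nH g h.
        of_bool ((g, h') \<in> M) * (xv g h' - eH h h') + eH h h' - 1) *
     (\<Prod>(g', _)\<in>Uc_set nG g h.
        of_bool ((g', h) \<in> M) * (xv g' h - eG g g') + eG g g' - 1)"

text \<open>For \<open>nG = nH = 1\<close> this set is \<open>{x\<^sub>1\<^sub>1 (x\<^sub>1\<^sub>1 - 1), x\<^sub>1\<^sub>1 - 1}\<close>, which is a Groebner basis but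
  not a reduced one.\<close>

definition viz_basis :: "nat \<Rightarrow> nat \<Rightarrow> viz_var rpoly set" where
  "viz_basis nG nH =
     {eG 1 g - 1 | g. g \<in> {1..nG} - {1}} \<union>
     {eH 1 h - 1 | h. h \<in> {1..nH} - {1}} \<union>
     {eG g g' * (eG g g' - 1) | g g'. g \<in> {1..nG} - {1} \<and> g' \<in> {1..nG} - {1} \<and> g \<noteq> g'} \<union>
     {eH h h' * (eH h h' - 1) | h h'. h \<in> {1..nH} - {1} \<and> h' \<in> {1..nH} - {1} \<and> h \<noteq> h'} \<union>
     {xv g h * (xv g h - 1) | g h. g \<in> {1..nG} \<and> h \<in> {1..nH}} \<union>
     {b_poly nG nH g h M | g h M. g \<in> {1..nG} \<and> h \<in> {1..nH} \<and> M \<subseteq> U_set nG nH g h}"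

end

theory Submission
  imports Defs
begin

text \<open>Each \<open>b\<^sub>g\<^sub>h\<^sub>,\<^sub>M\<close> is a product of factors \<open>v - 1\<close> over a set \<open>S\<close> of \<open>n\<^sub>G + n\<^sub>H - 1\<close> distinct variables,
  so its leading monomial is the product of \<open>S\<close>, and since these sets all have the same size the
  basis is reduced. Multiplying such a product by the domination generator at \<open>(g, h)\<close> does not
  change it modulo the idempotent relations, because \<open>(v - 1) (1 - q v) = (v - 1) - q v (v - 1)\<close>;
  hence it lies in the ideal.

  Let \<open>f\<close> be a nonzero element of the ideal whose leading monomial is divisible by no leading
  monomial of the basis. This monomial is a product of distinct variables from a set \<open>W\<close> that contains
  none of the sets \<open>S\<close>. For every \<open>A \<subseteq> W\<close> the point with coordinates 0 on \<open>A\<close> and 1 elsewhere is then a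
  zero of the ideal, and the sum of \<open>(-1)\<close> to the power \<open>|A|\<close> times the value of \<open>f\<close> there is the sum of
  the coefficients of the monomials of \<open>f\<close> involving all of \<open>W\<close>. By maximality of the degree only the
  leading one does, so the leading coefficient of \<open>f\<close> vanishes.\<close>

section \<open>Polynomial arithmetic\<close>

lemma poly_mapping_sum_single:
  "p = (\<Sum>t\<in>Poly_Mapping.keys p. Poly_Mapping.single t (Poly_Mapping.lookup p t))"
  by (rule poly_mapping_eqI)
    (auto simp: lookup_sum lookup_single when_def in_keys_iff)

lemma mult_eq_sum_single:
  "p * q = (\<Sum>s\<in>Poly_Mapping.keys p. \<Sum>t\<in>Poly_Mapping.keys q.
     Poly_Mapping.single (s + t) (Poly_Mapping.lookup p s * Poly_Mapping.lookup q t))"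
  for p q :: "'v rpoly"
proof -
  have "p * q = (\<Sum>t\<in>Poly_Mapping.keys p. Poly_Mapping.single t (Poly_Mapping.lookup p t))
      * (\<Sum>t\<in>Poly_Mapping.keys q. Poly_Mapping.single t (Poly_Mapping.lookup q t))"
    by (simp flip: poly_mapping_sum_single)
  then show ?thesis
    by (simp add: sum_product mult_single)
qed

lemma keys_plus_monom:
  "Poly_Mapping.keys (s + t) = Poly_Mapping.keys s \<union> Poly_Mapping.keys t" for s t :: "'v monom"
  by (auto simp: in_keys_iff lookup_add)

lemma ideal_genI:
  "finite F \<Longrightarrow> F \<subseteq> S \<Longrightarrow> (\<And>f. f \<in> F \<Longrightarrow> q f \<in> R) \<Longrightarrow> (\<Sum>f\<in>F. q f * f) \<in> ideal_gen R S"
  unfolding ideal_gen_def by blast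

section \<open>Closure properties of \<open>poly_ring\<close> and \<open>ideal_gen\<close>\<close>

context
  fixes K :: "real set" and V :: "'v set"
  assumes K: "real_subfield K"
begin

lemma poly_ring_zero: "0 \<in> poly_ring K V"
  using K by (simp add: poly_ring_def real_subfield_def)

lemma poly_ring_add: "p \<in> poly_ring K V \<Longrightarrow> q \<in> poly_ring K V \<Longrightarrow> p + q \<in> poly_ring K V"
  using K keys_add[of p q] unfolding poly_ring_def real_subfield_def
  by (simp add: lookup_add) blast

lemma poly_ring_diff: "p \<in> poly_ring K V \<Longrightarrow> q \<in> poly_ring K V \<Longrightarrow> p - q \<in> poly_ring K V"
  using K keys_diff[of p q] unfolding poly_ring_def real_subfield_def
  by (simp add: lookup_minus) blast

lemma poly_ring_sum: "(\<And>i. i \<in> J \<Longrightarrow> f i \<in> poly_ring K V) \<Longrightarrow> sum f J \<in> poly_ring K V"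
  by (induction J rule: infinite_finite_induct) (auto simp: poly_ring_zero poly_ring_add)

lemma poly_ring_single:
  "a \<in> K \<Longrightarrow> Poly_Mapping.keys t \<subseteq> V \<Longrightarrow> Poly_Mapping.single t a \<in> poly_ring K V"
  using K by (auto simp: poly_ring_def real_subfield_def lookup_single when_def)

lemma poly_ring_mult:
  assumes "p \<in> poly_ring K V" "q \<in> poly_ring K V"
  shows "p * q \<in> poly_ring K V"
  unfolding mult_eq_sum_single[of p q] using assms K
  by (intro poly_ring_sum poly_ring_single)
    (auto simp: poly_ring_def real_subfield_def keys_plus_monom)

lemma poly_ring_one: "1 \<in> poly_ring K V"
  using poly_ring_single[of 1 0] K by (simp add: real_subfield_def)

lemma poly_ring_prod: "(\<And>i. i \<in> J \<Longrightarrow> f i \<in> poly_ring K V) \<Longrightarrow> prod f J \<in> poly_ring K V"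
  by (induction J rule: infinite_finite_induct) (auto simp: poly_ring_one poly_ring_mult)

lemma poly_ring_pvar: "v \<in> V \<Longrightarrow> pvar v \<in> poly_ring K V"
  unfolding pvar_def using K by (intro poly_ring_single) (auto simp: real_subfield_def)

lemma ideal_gen_base: "f \<in> S \<Longrightarrow> q \<in> poly_ring K V \<Longrightarrow> q * f \<in> ideal_gen (poly_ring K V) S"
  using ideal_genI[of "{f}" S "\<lambda>_. q"] by simp

lemma ideal_gen_superset: "S \<subseteq> ideal_gen (poly_ring K V) S"
  using ideal_gen_base[OF _ poly_ring_one] by fastforce

lemma ideal_gen_zero: "0 \<in> ideal_gen (poly_ring K V) S"
  using ideal_genI[of "{}" S] by simp

lemma ideal_gen_add:
  assumes "a \<in> ideal_gen (poly_ring K V) S" "b \<in> ideal_gen (poly_ring K V) S"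
  shows "a + b \<in> ideal_gen (poly_ring K V) S"
proof -
  obtain F q where F: "a = (\<Sum>f\<in>F. q f * f)" "finite F" "F \<subseteq> S" "\<forall>f\<in>F. q f \<in> poly_ring K V"
    using assms(1) by (auto simp: ideal_gen_def)
  obtain F' q' where F': "b = (\<Sum>f\<in>F'. q' f * f)" "finite F'" "F' \<subseteq> S"
    "\<forall>f\<in>F'. q' f \<in> poly_ring K V"
    using assms(2) by (auto simp: ideal_gen_def)
  \<comment> \<open>Both representations are padded with zero coefficients to the union; a generator
    common to \<open>F\<close> and \<open>F'\<close> receives the sum of its two
    coefficients.\<close>
  let ?q = "\<lambda>f. (if f \<in> F then q f else 0) + (if f \<in> F' then q' f else 0)"
  have "a = (\<Sum>f\<in>F \<union> F'. (if f \<in> F then q f else 0) * f)"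
    unfolding F(1) using F(2) F'(2) by (intro sum.mono_neutral_cong_left) auto
  moreover have "b = (\<Sum>f\<in>F \<union> F'. (if f \<in> F' then q' f else 0) * f)"
    unfolding F'(1) using F(2) F'(2) by (intro sum.mono_neutral_cong_left) auto
  ultimately have "a + b = (\<Sum>f\<in>F \<union> F'. ?q f * f)"
    by (simp only: sum.distrib distrib_right)
  moreover have "?q f \<in> poly_ring K V" if "f \<in> F \<union> F'" for f
    using F(4) F'(4) by (auto intro!: poly_ring_add poly_ring_zero)
  ultimately show ?thesis
    using F(2,3) F'(2,3) ideal_genI[of "F \<union> F'" S ?q] by simp
qed

lemma ideal_gen_mult:
  assumes "a \<in> ideal_gen (poly_ring K V) S" "c \<in> poly_ring K V"
  shows "c * a \<in> ideal_gen (poly_ring K V) S"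
proof -
  obtain F q where F: "a = (\<Sum>f\<in>F. q f * f)" "finite F" "F \<subseteq> S" "\<forall>f\<in>F. q f \<in> poly_ring K V"
    using assms(1) by (auto simp: ideal_gen_def)
  have "c * a = (\<Sum>f\<in>F. (c * q f) * f)"
    by (simp add: F(1) sum_distrib_left mult.assoc)
  then show ?thesis
    using F(2-4) assms(2) by (simp add: ideal_genI poly_ring_mult)
qed

lemma ideal_gen_uminus:
  assumes "a \<in> ideal_gen (poly_ring K V) S"
  shows "- a \<in> ideal_gen (poly_ring K V) S"
  using ideal_gen_mult[OF assms poly_ring_diff[OF poly_ring_zero poly_ring_one]] by simp

lemma ideal_gen_diff:
  assumes "a \<in> ideal_gen (poly_ring K V) S" "b \<in> ideal_gen (poly_ring K V) S"
  shows "a - b \<in> ideal_gen (poly_ring K V) S"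
  using ideal_gen_add[OF assms(1) ideal_gen_uminus[OF assms(2)]] by simp

lemma ideal_gen_subsetI:
  assumes "S \<subseteq> ideal_gen (poly_ring K V) S'"
  shows "ideal_gen (poly_ring K V) S \<subseteq> ideal_gen (poly_ring K V) S'"
proof
  fix a assume "a \<in> ideal_gen (poly_ring K V) S"
  then obtain F q where F: "a = (\<Sum>f\<in>F. q f * f)" "finite F" "F \<subseteq> S" "\<forall>f\<in>F. q f \<in> poly_ring K V"
    by (auto simp: ideal_gen_def)
  have "(\<Sum>f\<in>F. q f * f) \<in> ideal_gen (poly_ring K V) S'"
    using F(2-4) assms
    by (induction F rule: finite_induct) (auto intro!: ideal_gen_zero ideal_gen_add ideal_gen_mult)
  then show "a \<in> ideal_gen (poly_ring K V) S'"
    by (simp add: F(1))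
qed

lemma ideal_gen_subset_ring:
  assumes "S \<subseteq> poly_ring K V"
  shows "ideal_gen (poly_ring K V) S \<subseteq> poly_ring K V"
  using assms by (auto simp: ideal_gen_def intro!: poly_ring_sum poly_ring_mult)

end

text \<open>A monomial that survives cancellation occurs in some summand \<open>q f * f\<close>. For
  an ideal of leading terms this turns non-divisibility into non-membership.\<close>

lemma keys_ideal_gen:
  assumes "p \<in> ideal_gen R S" "t \<in> Poly_Mapping.keys p"
  shows "\<exists>f\<in>S. \<exists>s\<in>Poly_Mapping.keys f. \<exists>u. t = u + s"
proof -
  obtain F q where F: "p = (\<Sum>f\<in>F. q f * f)" "F \<subseteq> S"
    using assms(1) by (auto simp: ideal_gen_def)
  obtain f where "f \<in> F" "t \<in> Poly_Mapping.keys (q f * f)"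
    using assms(2) keys_sum[of "\<lambda>f. q f * f" F] unfolding F(1) by auto
  then show ?thesis
    using F(2) keys_mult[of "q f" f] by blast
qed


section \<open>Evaluation at zero-one points\<close>

text \<open>The value of \<open>p\<close> at the point whose coordinates are 0 on \<open>A\<close> and 1 elsewhere.\<close>

definition eval01 :: "'v set \<Rightarrow> 'v rpoly \<Rightarrow> real" where
  "eval01 A p = (\<Sum>t\<in>Poly_Mapping.keys p.
     Poly_Mapping.lookup p t * of_bool (Poly_Mapping.keys t \<inter> A = {}))"

lemma eval01_add: "eval01 A (p + q) = eval01 A p + eval01 A q"
  unfolding eval01_def by (rule setsum_keys_plus_distrib) (auto simp: distrib_right)

lemma eval01_zero [simp]: "eval01 A 0 = 0"
  by (simp add: eval01_def)

lemma eval01_diff: "eval01 A (p - q) = eval01 A p - eval01 A q"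
  using eval01_add[of A "p - q" q] by simp

lemma eval01_sum: "eval01 A (sum f J) = (\<Sum>i\<in>J. eval01 A (f i))"
  by (induction J rule: infinite_finite_induct) (auto simp: eval01_add)

lemma eval01_single:
  "eval01 A (Poly_Mapping.single t a) = a * of_bool (Poly_Mapping.keys t \<inter> A = {})"
  by (simp add: eval01_def)

text \<open>The variables of \<open>s + t\<close> are those of \<open>s\<close> and those of
  \<open>t\<close>, so avoiding \<open>A\<close> is a multiplicative condition on monomials.\<close>

lemma eval01_mult: "eval01 A (p * q) = eval01 A p * eval01 A q"
  unfolding mult_eq_sum_single[of p q] eval01_sum eval01_single keys_plus_monom
  unfolding eval01_def sum_product
  by (intro sum.cong refl) (auto simp: Int_Un_distrib2)

lemma eval01_one [simp]: "eval01 A 1 = 1"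
  using eval01_single[of A 0 1] by simp

lemma eval01_pvar [simp]: "eval01 A (pvar v) = of_bool (v \<notin> A)"
  by (simp add: pvar_def eval01_single)

lemma eval01_prod: "eval01 A (prod f J) = (\<Prod>i\<in>J. eval01 A (f i))"
  by (induction J rule: infinite_finite_induct) (auto simp: eval01_mult)

lemma eval01_ideal_gen:
  assumes "p \<in> ideal_gen R S" "\<And>f. f \<in> S \<Longrightarrow> eval01 A f = 0"
  shows "eval01 A p = 0"
proof -
  obtain F q where F: "p = (\<Sum>f\<in>F. q f * f)" "F \<subseteq> S"
    using assms(1) by (auto simp: ideal_gen_def)
  then show ?thesis
    using assms(2) by (simp add: eval01_sum eval01_mult subset_iff)
qed

text \<open>Inclusion-exclusion: for a fixed monomial, the signed count of the subsets of
  \<open>W\<close> that avoid its support is 0 to the power of the number of elements of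
  \<open>W\<close> outside the support.\<close>

lemma sum_alternating_eval01:
  assumes "finite W"
  shows "(\<Sum>A\<in>Pow W. (-1) ^ card A * eval01 A p) =
    (\<Sum>t\<in>Poly_Mapping.keys p. Poly_Mapping.lookup p t * of_bool (W \<subseteq> Poly_Mapping.keys t))"
proof -
  have *: "(\<Sum>A\<in>Pow W. (-1) ^ card A * of_bool (Poly_Mapping.keys t \<inter> A = {})) =
      (of_bool (W \<subseteq> Poly_Mapping.keys t) :: real)" for t :: "'a monom"
  proof -
    have prod_of_bool: "(\<Prod>v\<in>A. of_bool (P v)) = (of_bool (\<forall>v\<in>A. P v) :: real)"
      if "finite A" for A and P :: "'a \<Rightarrow> bool"
      using that by induction auto
    \<comment> \<open>The indicator becomes a product over \<open>A\<close>, and a trivial product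
      over \<open>W - A\<close> is added, so that the sum is the expansion of a product of
      differences.\<close>
    have "(\<Sum>A\<in>Pow W. (-1) ^ card A * of_bool (Poly_Mapping.keys t \<inter> A = {})) =
      (\<Sum>A\<in>Pow W. (-1) ^ card A * (\<Prod>v\<in>A. of_bool (v \<notin> Poly_Mapping.keys t)) * (\<Prod>v\<in>W - A. 1 :: real))"
      using assms by (intro sum.cong refl, subst prod_of_bool) (auto dest: finite_subset)
    also have "\<dots> = (\<Prod>v\<in>W. 1 - of_bool (v \<notin> Poly_Mapping.keys t))"
      by (rule prod_diff_conv_sum[symmetric]) (rule assms)
    also have "\<dots> = (\<Prod>v\<in>W. of_bool (v \<in> Poly_Mapping.keys t))"
      by (rule prod.cong) auto
    also have "\<dots> = of_bool (W \<subseteq> Poly_Mapping.keys t)"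
      using assms by (subst prod_of_bool) auto
    finally show ?thesis .
  qed
  have "(\<Sum>A\<in>Pow W. (-1) ^ card A * eval01 A p) = (\<Sum>t\<in>Poly_Mapping.keys p. Poly_Mapping.lookup p t *
      (\<Sum>A\<in>Pow W. (-1) ^ card A * of_bool (Poly_Mapping.keys t \<inter> A = {})))"
    unfolding eval01_def sum_distrib_left by (subst sum.swap) (simp add: mult_ac)
  then show ?thesis
    by (simp only: *)
qed


section \<open>Leading monomials\<close>

text \<open>Since \<open>r\<close> orders only \<open>V\<close>, the monomials are restricted to
  variables in \<open>V\<close>. Of the variables deciding \<open>s\<close> against \<open>t\<close>
  and \<open>t\<close> against \<open>w\<close>, the \<open>r\<close>-larger one decides
  \<open>s\<close> against \<open>w\<close>.\<close>

lemma deglex_transp: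
  assumes r: "linear_order_on V r" and V: "\<And>t. t \<in> M \<Longrightarrow> Poly_Mapping.keys t \<subseteq> V"
  shows "transp_on M (deglex r)"
proof (rule transp_onI)
  fix s t w assume M: "s \<in> M" "t \<in> M" "w \<in> M" and st: "deglex r s t" and tw: "deglex r t w"
  show "deglex r s w"
  proof (cases "mon_deg s = mon_deg t \<and> mon_deg t = mon_deg w")
    case False
    then show ?thesis using st tw by (auto simp: deglex_def)
  next
    case True
    then obtain v u where
      v: "Poly_Mapping.lookup s v < Poly_Mapping.lookup t v"
        "\<And>z. (v, z) \<in> r \<Longrightarrow> z \<noteq> v \<Longrightarrow> Poly_Mapping.lookup s z = Poly_Mapping.lookup t z" and
      u: "Poly_Mapping.lookup t u < Poly_Mapping.lookup w u"
        "\<And>z. (u, z) \<in> r \<Longrightarrow> z \<noteq> u \<Longrightarrow> Poly_Mapping.lookup t z = Poly_Mapping.lookup w z"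
      using st tw by (auto simp: deglex_def)
    have tr: "trans r" and an: "antisym r" and to: "total_on V r"
      using r by (auto simp: linear_order_on_def partial_order_on_def preorder_on_def)
    \<comment> \<open>A deciding variable has positive exponent in the larger of the two
      monomials.\<close>
    have "v \<in> V" "u \<in> V"
      using v(1) u(1) V M(2,3) by (metis gr_implies_not0 in_keys_iff subsetD)+
    then consider "v = u" | "(v, u) \<in> r" "v \<noteq> u" | "(u, v) \<in> r" "v \<noteq> u"
      using to by (auto simp: total_on_def)
    then show ?thesis
    proof cases
      case 1
      then show ?thesis using True v u unfolding deglex_def by (metis order.strict_trans)
    next
      case 2
      have "Poly_Mapping.lookup s z = Poly_Mapping.lookup w z" if "(u, z) \<in> r" "z \<noteq> u" for z
        using that v(2)[of z] u(2)[of z] 2 tr an by (metis transD antisymD)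
      moreover have "Poly_Mapping.lookup s u < Poly_Mapping.lookup w u"
        using 2 v(2)[of u] u(1) by simp
      ultimately show ?thesis using True unfolding deglex_def by auto
    next
      case 3
      have "Poly_Mapping.lookup s z = Poly_Mapping.lookup w z" if "(v, z) \<in> r" "z \<noteq> v" for z
        using that v(2)[of z] u(2)[of z] 3 tr an by (metis transD antisymD)
      moreover have "Poly_Mapping.lookup s v < Poly_Mapping.lookup w v"
        using 3 v(1) u(2)[of v] by simp
      ultimately show ?thesis using True unfolding deglex_def by auto
    qed
  qed
qed

text \<open>Two distinct monomials differ at finitely many variables, at least one; the
  \<open>r\<close>-largest of these breaks a tie in the degree.\<close>

lemma deglex_totalp:
  assumes r: "linear_order_on V r" and V: "\<And>t. t \<in> M \<Longrightarrow> Poly_Mapping.keys t \<subseteq> V"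
  shows "totalp_on M (deglex r)"
proof (rule totalp_onI)
  fix s t assume M: "s \<in> M" "t \<in> M" and "s \<noteq> t"
  have tr: "trans r" and an: "antisym r" and to: "total_on V r"
    using r by (auto simp: linear_order_on_def partial_order_on_def preorder_on_def)
  define D where "D = {v. Poly_Mapping.lookup s v \<noteq> Poly_Mapping.lookup t v}"
  have D: "D \<subseteq> Poly_Mapping.keys s \<union> Poly_Mapping.keys t"
    by (auto simp: D_def in_keys_iff)
  then have "finite D" "D \<subseteq> V"
    using V M by (auto intro: finite_subset)
  have "D \<noteq> {}"
    using \<open>s \<noteq> t\<close> poly_mapping_eqI[of s t] unfolding D_def by blast
  have "\<exists>m\<in>D. \<forall>x\<in>D. x \<noteq> m \<longrightarrow> (x, m) \<in> r"
    using \<open>finite D\<close> \<open>D \<noteq> {}\<close>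
  proof (rule Finite_Set.bex_greatest_element)
    show "transp_on D (\<lambda>x y. (x, y) \<in> r)"
      using tr by (auto intro: transp_onI dest: transD)
    show "totalp_on D (\<lambda>x y. (x, y) \<in> r)"
      using to \<open>D \<subseteq> V\<close> by (auto intro!: totalp_onI simp: total_on_def)
  qed
  then obtain m where m: "m \<in> D" "\<And>x. x \<in> D \<Longrightarrow> x \<noteq> m \<Longrightarrow> (x, m) \<in> r"
    by auto
  have "Poly_Mapping.lookup s u = Poly_Mapping.lookup t u" if "(m, u) \<in> r" "u \<noteq> m" for u
    using that m(2)[of u] an by (auto simp: D_def dest: antisymD)
  then show "deglex r s t \<or> deglex r t s"
    using m(1) unfolding deglex_def D_def by (metis (mono_tags, lifting) linorder_neqE_nat mem_Collect_eq)
qed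

text \<open>The finite nonempty support has a unique greatest monomial, which gives meaning to the
  definite description in \<open>lead_monom\<close>. Of its maximality only the degree bound is
  recorded.\<close>

lemma lead_monom_in_keys:
  assumes r: "linear_order_on V r" and p: "p \<in> poly_ring K V" "p \<noteq> 0"
  shows "lead_monom (deglex r) p \<in> Poly_Mapping.keys p"
    and "s \<in> Poly_Mapping.keys p \<Longrightarrow> mon_deg s \<le> mon_deg (lead_monom (deglex r) p)"
proof -
  let ?P = "\<lambda>t. t \<in> Poly_Mapping.keys p \<and> (\<forall>s\<in>Poly_Mapping.keys p. s \<noteq> t \<longrightarrow> deglex r s t)"
  have V: "\<And>t. t \<in> Poly_Mapping.keys p \<Longrightarrow> Poly_Mapping.keys t \<subseteq> V"
    using p(1) by (auto simp: poly_ring_def)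
  have "Poly_Mapping.keys p \<noteq> {}"
    using p(2) by simp
  then obtain t where t: "?P t"
    using Finite_Set.bex_greatest_element[OF finite_keys _ deglex_transp[OF r V] deglex_totalp[OF r V]]
    by blast
  have irr: "\<not> deglex r s s" for s
    by (simp add: deglex_def)
  have "s = t" if "?P s" for s
  proof (rule ccontr)
    assume "s \<noteq> t"
    then have "deglex r s t" "deglex r t s"
      using that t by auto
    then show False
      using transp_onD[OF deglex_transp[OF r V], where x = s and y = t and z = s] that t irr by auto
  qed
  then have "?P (lead_monom (deglex r) p)"
    unfolding lead_monom_def using t by (intro theI[of ?P]) auto
  then show "lead_monom (deglex r) p \<in> Poly_Mapping.keys p"
    and "s \<in> Poly_Mapping.keys p \<Longrightarrow> mon_deg s \<le> mon_deg (lead_monom (deglex r) p)"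
    by (auto simp: deglex_def)
qed

text \<open>Each basis polynomial has a single monomial of top degree, so its leading monomial is
  the same for every \<open>r\<close>.\<close>

lemma lead_monom_eqI:
  assumes "t \<in> Poly_Mapping.keys p"
    and "\<And>s. s \<in> Poly_Mapping.keys p \<Longrightarrow> s \<noteq> t \<Longrightarrow> mon_deg s < mon_deg t"
  shows "lead_monom (deglex r) p = t"
  unfolding lead_monom_def
proof (rule the_equality)
  show "t \<in> Poly_Mapping.keys p \<and> (\<forall>s\<in>Poly_Mapping.keys p. s \<noteq> t \<longrightarrow> deglex r s t)"
    using assms by (auto simp: deglex_def)
  show "s = t" if "s \<in> Poly_Mapping.keys p \<and> (\<forall>u\<in>Poly_Mapping.keys p. u \<noteq> s \<longrightarrow> deglex r u s)" for s
    using that assms by (fastforce simp: deglex_def)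
qed


section \<open>Squarefree monomials and products of \<open>v - 1\<close>\<close>

definition sqfree :: "'v set \<Rightarrow> 'v monom" where
  "sqfree A = (\<Sum>v\<in>A. Poly_Mapping.single v 1)"

lemma lookup_sqfree: "finite A \<Longrightarrow> Poly_Mapping.lookup (sqfree A) v = of_bool (v \<in> A)"
  by (simp add: sqfree_def lookup_sum lookup_single when_def)

lemma keys_sqfree: "finite A \<Longrightarrow> Poly_Mapping.keys (sqfree A) = A"
  by (auto simp: in_keys_iff lookup_sqfree)

lemma mon_deg_sqfree: "finite A \<Longrightarrow> mon_deg (sqfree A) = card A"
  by (simp add: mon_deg_def keys_sqfree lookup_sqfree)

lemma sqfree_inject: "finite A \<Longrightarrow> finite B \<Longrightarrow> sqfree A = sqfree B \<longleftrightarrow> A = B"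
  by (metis keys_sqfree)

text \<open>The cofactor is \<open>t - sqfree A\<close>; nothing is truncated, because the variables
  in \<open>A\<close> have positive exponent in \<open>t\<close>.\<close>

lemma sqfree_dvd: "A \<subseteq> Poly_Mapping.keys t \<Longrightarrow> \<exists>u. t = u + sqfree A"
proof (rule exI[of _ "t - sqfree A"], rule poly_mapping_eqI)
  fix v assume "A \<subseteq> Poly_Mapping.keys t"
  then have "finite A" "v \<in> A \<Longrightarrow> 0 < Poly_Mapping.lookup t v"
    by (auto intro: finite_subset[OF _ finite_keys] simp: in_keys_iff)
  then show "Poly_Mapping.lookup t v = Poly_Mapping.lookup (t - sqfree A + sqfree A) v"
    by (auto simp: lookup_add lookup_minus lookup_sqfree)
qed

text \<open>For finite \<open>S\<close> this is nonzero at the zero-one point of \<open>A\<close>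
  exactly if \<open>S\<close> is a subset of \<open>A\<close>.\<close>

definition coord_prod :: "'v set \<Rightarrow> 'v rpoly" where
  "coord_prod S = (\<Prod>v\<in>S. pvar v - 1)"

text \<open>The factors indexed by \<open>A\<close> contribute their variable, the others -1.
  Distinct subsets give distinct monomials, so the support and the leading coefficient can be read
  off.\<close>

lemma coord_prod_eq_sum:
  assumes "finite S"
  shows "coord_prod S = (\<Sum>A\<in>Pow S. Poly_Mapping.single (sqfree A) ((-1) ^ (card S - card A)))"
proof -
  have pv: "prod pvar A = Poly_Mapping.single (sqfree A) (1 :: real)" if "finite A" for A :: "'a set"
    using that by induction (auto simp: sqfree_def pvar_def mult_single)
  have sgn: "(-1) ^ k = (Poly_Mapping.single 0 ((-1) ^ k) :: 'a rpoly)" for k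
    by (induction k) (auto simp: single_uminus)
  have "coord_prod S = (\<Sum>A\<in>Pow S. (-1) ^ (card S - card A) * prod pvar A * (\<Prod>v\<in>S - A. 1))"
    unfolding coord_prod_def by (rule prod_diff_conv_sum'[OF assms])
  also have "\<dots> = (\<Sum>A\<in>Pow S. Poly_Mapping.single (sqfree A) ((-1) ^ (card S - card A)))"
    using assms by (intro sum.cong refl) (auto simp: pv sgn mult_single dest: finite_subset)
  finally show ?thesis .
qed

lemma keys_coord_prod: "finite S \<Longrightarrow> Poly_Mapping.keys (coord_prod S) \<subseteq> sqfree ` Pow S"
  unfolding coord_prod_eq_sum by (rule order_trans[OF keys_sum]) auto

lemma lookup_coord_prod:
  assumes "finite S"
  shows "Poly_Mapping.lookup (coord_prod S) (sqfree S) = 1"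
proof -
  have "Poly_Mapping.lookup (coord_prod S) (sqfree S) =
      (\<Sum>A\<in>Pow S. if A = S then (-1) ^ (card S - card A) else 0)"
    unfolding coord_prod_eq_sum[OF assms] lookup_sum using assms
    by (intro sum.cong refl) (auto simp: lookup_single when_def sqfree_inject dest: finite_subset)
  then show ?thesis
    using assms by simp
qed

lemma lead_monom_coord_prod:
  assumes "finite S"
  shows "lead_monom (deglex r) (coord_prod S) = sqfree S"
proof (rule lead_monom_eqI)
  show "sqfree S \<in> Poly_Mapping.keys (coord_prod S)"
    using lookup_coord_prod[OF assms] by (simp add: in_keys_iff)
  fix s assume "s \<in> Poly_Mapping.keys (coord_prod S)" "s \<noteq> sqfree S"
  then obtain A where "s = sqfree A" "A \<subset> S"
    using keys_coord_prod[OF assms] by auto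
  moreover from this have "finite A"
    using assms finite_subset by blast
  ultimately show "mon_deg s < mon_deg (sqfree S)"
    using assms by (simp add: mon_deg_sqfree psubset_card_mono)
qed

lemma pvar_idempotent_eq:
  "pvar v * (pvar v - 1) = Poly_Mapping.single (Poly_Mapping.single v 2) 1 - pvar v"
  by (simp add: right_diff_distrib pvar_def mult_single numeral_2_eq_2 flip: single_add)

lemma keys_pvar_idempotent:
  "Poly_Mapping.keys (pvar v * (pvar v - 1)) \<subseteq> {Poly_Mapping.single v 2, Poly_Mapping.single v 1}"
  unfolding pvar_idempotent_eq by (rule order_trans[OF keys_diff]) (auto simp: pvar_def)

lemma lookup_pvar_idempotent:
  "Poly_Mapping.lookup (pvar v * (pvar v - 1)) (Poly_Mapping.single v 2) = 1"
proof -
  have "Poly_Mapping.single v (1 :: nat) \<noteq> Poly_Mapping.single v 2"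
    by (metis lookup_single_eq numeral_eq_one_iff semiring_norm(85))
  then show ?thesis
    unfolding pvar_idempotent_eq by (simp add: lookup_minus pvar_def lookup_single when_def)
qed

lemma lead_monom_pvar_idempotent:
  "lead_monom (deglex r) (pvar v * (pvar v - 1)) = Poly_Mapping.single v 2"
proof (rule lead_monom_eqI)
  show "Poly_Mapping.single v 2 \<in> Poly_Mapping.keys (pvar v * (pvar v - 1))"
    using lookup_pvar_idempotent[of v] by (simp add: in_keys_iff)
  fix s assume "s \<in> Poly_Mapping.keys (pvar v * (pvar v - 1))" "s \<noteq> Poly_Mapping.single v 2"
  then have "s = Poly_Mapping.single v 1"
    using keys_pvar_idempotent[of v] by blast
  then show "mon_deg s < mon_deg (Poly_Mapping.single v 2)"
    by (simp add: mon_deg_def)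
qed


section \<open>Reduced Groebner bases from antichains\<close>

lemma monom_eq_sqfree:
  assumes "\<And>v. v \<in> Poly_Mapping.keys t \<Longrightarrow> Poly_Mapping.lookup t v = 1"
  shows "t = sqfree (Poly_Mapping.keys t)"
  using assms by (intro poly_mapping_eqI) (auto simp: lookup_sqfree in_keys_iff)

text \<open>As \<open>sqfree W\<close> divides \<open>t\<close>, its exponents are bounded by those
  of \<open>t\<close>; the degree bound forces equal sums and hence equal exponents.\<close>

lemma monom_eq_sqfreeI:
  assumes "finite W" "W \<subseteq> Poly_Mapping.keys t" "mon_deg t \<le> card W"
  shows "t = sqfree W"
proof -
  obtain u where u: "t = u + sqfree W"
    using sqfree_dvd[OF assms(2)] by blast
  have le: "Poly_Mapping.lookup (sqfree W) v \<le> Poly_Mapping.lookup t v" for v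
    by (simp add: u lookup_add)
  have "(\<Sum>v\<in>Poly_Mapping.keys t. Poly_Mapping.lookup (sqfree W) v) = card W"
    using assms by (simp add: lookup_sqfree Int_absorb1)
  then have "(\<Sum>v\<in>Poly_Mapping.keys t. Poly_Mapping.lookup (sqfree W) v) =
      (\<Sum>v\<in>Poly_Mapping.keys t. Poly_Mapping.lookup t v)"
    using assms(3) sum_mono[of "Poly_Mapping.keys t" "Poly_Mapping.lookup (sqfree W)", OF le] unfolding mon_deg_def by linarith
  then have eq: "Poly_Mapping.lookup t v = Poly_Mapping.lookup (sqfree W) v"
    if "v \<in> Poly_Mapping.keys t" for v
    using sum_mono_inv[of "Poly_Mapping.lookup (sqfree W)" _ "Poly_Mapping.lookup t", OF _ le that] by simp
  show ?thesis
  proof (rule poly_mapping_eqI)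
    show "Poly_Mapping.lookup t v = Poly_Mapping.lookup (sqfree W) v" for v
      using eq[of v] le[of v] by (cases "v \<in> Poly_Mapping.keys t") (auto simp: in_keys_iff)
  qed
qed

text \<open>If both alternatives fail, the leading monomial is \<open>sqfree W\<close> and every
  subset of \<open>W\<close> gives a zero of \<open>p\<close>. The alternating sum over these zeros
  equals the leading coefficient, which is nonzero.\<close>

lemma lead_monom_dvd_of_vanishing:
  fixes p :: "'v rpoly"
  assumes r: "linear_order_on V r" and p: "p \<in> poly_ring K V" "p \<noteq> 0"
    and van: "\<And>A. A \<subseteq> V \<Longrightarrow> \<forall>S\<in>F. \<not> S \<subseteq> A \<Longrightarrow> eval01 A p = 0"
  shows "(\<exists>v. Poly_Mapping.lookup (lead_monom (deglex r) p) v \<ge> 2) \<or>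
    (\<exists>S\<in>F. S \<subseteq> Poly_Mapping.keys (lead_monom (deglex r) p))"
proof (rule ccontr)
  let ?t = "lead_monom (deglex r) p"
  define W where "W = Poly_Mapping.keys ?t"
  assume "\<not> ?thesis"
  then have small: "Poly_Mapping.lookup ?t v < 2" and F: "\<forall>S\<in>F. \<not> S \<subseteq> W" for v
    by (auto simp: not_le W_def)
  have "Poly_Mapping.lookup ?t v = 1" if "v \<in> Poly_Mapping.keys ?t" for v
    using small[of v] that by (simp add: in_keys_iff)
  then have t: "?t = sqfree W"
    unfolding W_def by (rule monom_eq_sqfree)
  have fin: "finite W"
    by (simp add: W_def)
  have key: "?t \<in> Poly_Mapping.keys p"
    by (rule lead_monom_in_keys[OF r p])
  then have "W \<subseteq> V"
    using p(1) by (auto simp: poly_ring_def W_def)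
  \<comment> \<open>Containing all of \<open>W\<close> forces degree at least \<open>card W\<close>,
    and no monomial of \<open>p\<close> exceeds the degree of the leading one.\<close>
  have only: "s = ?t" if "s \<in> Poly_Mapping.keys p" "W \<subseteq> Poly_Mapping.keys s" for s
    using monom_eq_sqfreeI[OF fin that(2)] lead_monom_in_keys(2)[OF r p that(1)] fin
    by (simp add: t mon_deg_sqfree)
  have "eval01 A p = 0" if "A \<subseteq> W" for A
    using van[of A] that F \<open>W \<subseteq> V\<close> by blast
  then have "0 = (\<Sum>A\<in>Pow W. (-1) ^ card A * eval01 A p)"
    by simp
  also have "\<dots> = (\<Sum>s\<in>Poly_Mapping.keys p.
      Poly_Mapping.lookup p s * of_bool (W \<subseteq> Poly_Mapping.keys s))"
    by (rule sum_alternating_eval01[OF fin])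
  also have "\<dots> = (\<Sum>s\<in>Poly_Mapping.keys p. if s = ?t then Poly_Mapping.lookup p s else 0)"
    using only by (intro sum.cong refl) (auto simp: W_def)
  also have "\<dots> = Poly_Mapping.lookup p ?t"
    using key by simp
  finally show False
    using key by (simp add: in_keys_iff)
qed

text \<open>For \<open>{v}\<close> in \<open>F\<close> the basis contains \<open>pvar v - 1\<close>,
  whose leading monomial divides the square of \<open>v\<close>; reducedness therefore excludes the
  idempotent relation of \<open>v\<close>.\<close>

definition antichain_basis :: "'v set \<Rightarrow> 'v set set \<Rightarrow> 'v rpoly set" where
  "antichain_basis V F = {pvar v * (pvar v - 1) | v. v \<in> V \<and> {v} \<notin> F} \<union> coord_prod ` F"

lemma lead_coef_antichain_basis:
  assumes "finite V" "F \<subseteq> Pow V" "p \<in> antichain_basis V F"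
  shows "lead_coef (deglex r) p = 1"
proof -
  have "finite S" if "S \<in> F" for S
    using that assms finite_subset by blast
  then show ?thesis
    using assms(3) unfolding antichain_basis_def lead_coef_def
    by (auto simp: lead_monom_pvar_idempotent lookup_pvar_idempotent
        lead_monom_coord_prod lookup_coord_prod)
qed

lemma antichain_basis_lead_dvd:
  assumes V: "finite V" "F \<subseteq> Pow V" and t: "Poly_Mapping.keys t \<subseteq> V"
    and div: "(\<exists>v. Poly_Mapping.lookup t v \<ge> 2) \<or> (\<exists>S\<in>F. S \<subseteq> Poly_Mapping.keys t)"
  shows "\<exists>g\<in>antichain_basis V F. \<exists>u. t = u + lead_monom (deglex r) g"
proof (cases "\<exists>S\<in>F. S \<subseteq> Poly_Mapping.keys t")
  case True
  then obtain S u where "S \<in> F" "t = u + sqfree S"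
    using sqfree_dvd by metis
  moreover have "finite S"
    using V \<open>S \<in> F\<close> finite_subset by blast
  moreover have "coord_prod S \<in> antichain_basis V F"
    using \<open>S \<in> F\<close> by (simp add: antichain_basis_def)
  ultimately show ?thesis
    using lead_monom_coord_prod[of S r] by metis
next
  case False
  then obtain v where v: "Poly_Mapping.lookup t v \<ge> 2"
    using div by blast
  then have "v \<in> Poly_Mapping.keys t"
    by (simp add: in_keys_iff)
  \<comment> \<open>No member of \<open>F\<close> lies in the support of \<open>t\<close>, so
    \<open>{v}\<close> is not in \<open>F\<close> and the idempotent relation of \<open>v\<close>
    was kept.\<close>
  then have "pvar v * (pvar v - 1) \<in> antichain_basis V F"
    using False t unfolding antichain_basis_def by blast
  moreover have "t = (t - Poly_Mapping.single v 2) + Poly_Mapping.single v 2"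
    using v by (intro poly_mapping_eqI) (auto simp: lookup_add lookup_minus lookup_single when_def)
  ultimately show ?thesis
    using lead_monom_pvar_idempotent[of r v] by metis
qed

text \<open>Squares do not occur in a \<open>coord_prod\<close>, and a square of \<open>v\<close>
  occurs only in the relation of \<open>v\<close>. A member of \<open>F\<close> inside
  \<open>{w}\<close> would be empty or \<open>{w}\<close>, and one inside another member equals
  it.\<close>

lemma antichain_basis_reduced:
  assumes V: "finite V" "F \<subseteq> Pow V" "{} \<notin> F"
    and anti: "\<And>S S'. S \<in> F \<Longrightarrow> S' \<in> F \<Longrightarrow> S \<subseteq> S' \<Longrightarrow> S = S'"
    and p: "p \<in> antichain_basis V F" "t \<in> Poly_Mapping.keys p"
    and g: "g \<in> antichain_basis V F" "t = u + lead_monom (deglex r) g"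
  shows "g = p"
proof -
  have fin: "finite S" if "S \<in> F" for S
    using that V finite_subset by blast
  consider (idem) v where "g = pvar v * (pvar v - 1)" "Poly_Mapping.lookup t v \<ge> 2"
    | (prod) S where "S \<in> F" "g = coord_prod S" "S \<subseteq> Poly_Mapping.keys t"
    using g unfolding antichain_basis_def
    by (auto simp: lead_monom_pvar_idempotent lead_monom_coord_prod fin lookup_add lookup_single
        keys_plus_monom keys_sqfree)
  then show ?thesis
  proof cases
    case idem
    have False if S: "S \<in> F" "p = coord_prod S" for S
    proof -
      obtain A where A: "t = sqfree A" "A \<subseteq> S"
        using keys_coord_prod[OF fin[OF S(1)]] p(2) S(2) by auto
      then have "finite A"
        using fin[OF S(1)] finite_subset by blast
      then show False
        using idem(2) A(1) by (simp add: lookup_sqfree of_bool_def split: if_splits)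
    qed
    then obtain w where w: "p = pvar w * (pvar w - 1)"
      using p(1) unfolding antichain_basis_def by blast
    then have "t \<in> {Poly_Mapping.single w 2, Poly_Mapping.single w 1}"
      using p(2) keys_pvar_idempotent[of w] by blast
    then have "v = w"
      using idem(2) by (auto simp: lookup_single when_def split: if_splits)
    then show ?thesis
      by (simp add: idem(1) w)
  next
    case prod
    have False if "w \<in> V" "{w} \<notin> F" "p = pvar w * (pvar w - 1)" for w
    proof -
      have "t \<in> {Poly_Mapping.single w 2, Poly_Mapping.single w 1}"
        using p(2) keys_pvar_idempotent[of w] that(3) by blast
      then have "S \<subseteq> {w}"
        using prod(3) by auto
      then show False
        using prod(1) V(3) that(2) by (auto simp: subset_singleton_iff)
    qed
    then obtain S' where S': "S' \<in> F" "p = coord_prod S'"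
      using p(1) unfolding antichain_basis_def by blast
    then obtain A where "t = sqfree A" "A \<subseteq> S'"
      using keys_coord_prod[OF fin] p(2) by blast
    then have "S \<subseteq> S'"
      using prod(3) keys_sqfree[of A] finite_subset[OF _ fin[OF S'(1)]] by auto
    then show ?thesis
      using anti prod(1,2) S' by blast
  qed
qed

text \<open>The members of \<open>F\<close> act as minimal nonfaces of a simplicial complex on
  \<open>V\<close>: by \<open>van\<close> every face gives a zero of the ideal. These zeros force
  divisibility of leading monomials, so no S-polynomials are computed.\<close>

theorem antichain_reduced_groebner_basis:
  assumes K: "real_subfield K" and r: "linear_order_on V r"
    and V: "finite V" "F \<subseteq> Pow V" "{} \<notin> F"
    and anti: "\<And>S S'. S \<in> F \<Longrightarrow> S' \<in> F \<Longrightarrow> S \<subseteq> S' \<Longrightarrow> S = S'"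
    and X: "X \<subseteq> poly_ring K V"
    and van: "\<And>A f. A \<subseteq> V \<Longrightarrow> \<forall>S\<in>F. \<not> S \<subseteq> A \<Longrightarrow> f \<in> X \<Longrightarrow> eval01 A f = 0"
    and sub: "antichain_basis V F \<subseteq> ideal_gen (poly_ring K V) X"
  shows "is_reduced_groebner_basis (deglex r) (poly_ring K V) (ideal_gen (poly_ring K V) X)
    (antichain_basis V F)"
proof -
  let ?R = "poly_ring K V" and ?G = "antichain_basis V F" and ?lt = "lead_term (deglex r)"
  let ?I = "ideal_gen ?R X"
  have "finite F"
    using V finite_subset by blast
  then have finG: "finite ?G"
    using V(1) unfolding antichain_basis_def by simp
  have lc: "lead_coef (deglex r) p = 1" if "p \<in> ?G" for p
    using lead_coef_antichain_basis[OF V(1,2) that] .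
  have lt: "?lt p = Poly_Mapping.single (lead_monom (deglex r) p) 1" if "p \<in> ?G" for p
    by (simp add: lead_term_def lc[OF that])
  \<comment> \<open>The leading coefficient of 0 is 0, whatever its unspecified leading monomial
    is.\<close>
  have nz: "0 \<notin> ?G"
    using lc[of 0] by (auto simp: lead_coef_def)
  have IR: "?I \<subseteq> ?R"
    by (rule ideal_gen_subset_ring[OF K X])
  have "ideal_gen ?R (?lt ` ?G) \<subseteq> ideal_gen ?R (?lt ` (?I - {0}))"
  proof (rule ideal_gen_subsetI[OF K])
    have "?lt ` ?G \<subseteq> ?lt ` (?I - {0})"
      using sub nz by (intro image_mono) blast
    also have "\<dots> \<subseteq> ideal_gen ?R (?lt ` (?I - {0}))"
      by (rule ideal_gen_superset[OF K])
    finally show "?lt ` ?G \<subseteq> ideal_gen ?R (?lt ` (?I - {0}))" .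
  qed
  moreover have "?lt f \<in> ideal_gen ?R (?lt ` ?G)" if f: "f \<in> ?I" "f \<noteq> 0" for f
  proof -
    let ?t = "lead_monom (deglex r) f"
    have fR: "f \<in> ?R"
      using f IR by blast
    have t: "?t \<in> Poly_Mapping.keys f"
      by (rule lead_monom_in_keys[OF r fR f(2)])
    then have tV: "Poly_Mapping.keys ?t \<subseteq> V"
      using fR by (auto simp: poly_ring_def)
    have "eval01 A f = 0" if "A \<subseteq> V" "\<forall>S\<in>F. \<not> S \<subseteq> A" for A
      using eval01_ideal_gen[OF f(1)] van[OF that] by blast
    from lead_monom_dvd_of_vanishing[OF r fR f(2) this]
    obtain g u where g: "g \<in> ?G" "?t = u + lead_monom (deglex r) g"
      using antichain_basis_lead_dvd[OF V(1,2) tV] by blast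
    then have "?lt f = Poly_Mapping.single u (lead_coef (deglex r) f) * ?lt g"
      by (simp add: lead_term_def lc mult_single)
    moreover have "Poly_Mapping.single u (lead_coef (deglex r) f) \<in> ?R"
      using fR tV g(2) by (intro poly_ring_single[OF K])
        (auto simp: poly_ring_def lead_coef_def keys_plus_monom)
    ultimately show ?thesis
      using ideal_gen_base[OF K, of "?lt g"] g(1) by simp
  qed
  ultimately have "ideal_gen ?R (?lt ` ?G) = ideal_gen ?R (?lt ` (?I - {0}))"
    by (intro antisym ideal_gen_subsetI[OF K, of "?lt ` (?I - {0})"]) auto
  moreover have "Poly_Mapping.single t 1 \<notin> ideal_gen ?R (?lt ` (?G - {p}))"
    if p: "p \<in> ?G" "t \<in> Poly_Mapping.keys p" for p t
  proof
    assume "Poly_Mapping.single t 1 \<in> ideal_gen ?R (?lt ` (?G - {p}))"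
    from keys_ideal_gen[OF this, of t]
    obtain g s u where g: "g \<in> ?G - {p}" "s \<in> Poly_Mapping.keys (?lt g)" "t = u + s"
      by auto
    then have "t = u + lead_monom (deglex r) g"
      using lt[of g] by simp
    then show False
      using antichain_basis_reduced[OF V anti p] g(1) by blast
  qed
  ultimately show ?thesis
    unfolding is_reduced_groebner_basis_def is_groebner_basis_def
    using finG sub lc by blast
qed


section \<open>The Vizing ideal\<close>

text \<open>If each factor fixes \<open>b\<close> modulo the ideal, so does their product, one
  factor at a time.\<close>

lemma prod_absorb_mod_ideal:
  assumes K: "real_subfield K" and b: "b \<in> poly_ring K V"
    and f: "\<And>i. i \<in> J \<Longrightarrow> f i \<in> poly_ring K V"
      "\<And>i. i \<in> J \<Longrightarrow> b * f i - b \<in> ideal_gen (poly_ring K V) X"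
  shows "b * prod f J - b \<in> ideal_gen (poly_ring K V) X"
  using f
proof (induction J rule: infinite_finite_induct)
  case (insert i J)
  have "f i * (b * prod f J - b) + (b * f i - b) \<in> ideal_gen (poly_ring K V) X"
    using insert by (intro ideal_gen_add[OF K] ideal_gen_mult[OF K]) auto
  moreover have "f i * (b * prod f J - b) + (b * f i - b) = b * prod f (insert i J) - b"
    using insert.hyps by (simp add: algebra_simps)
  ultimately show ?case
    by simp
qed (auto simp: ideal_gen_zero[OF K])

lemma coord_prod_in_ring:
  "real_subfield K \<Longrightarrow> S \<subseteq> V \<Longrightarrow> coord_prod S \<in> poly_ring K V"
  unfolding coord_prod_def
  by (intro poly_ring_prod poly_ring_diff poly_ring_pvar poly_ring_one) auto

text \<open>Splitting off the factor \<open>pvar v - 1\<close>, the difference becomes a multiple of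
  the idempotent relation of \<open>v\<close>.\<close>

lemma coord_prod_absorb:
  assumes K: "real_subfield K" and S: "finite S" "S \<subseteq> V" "v \<in> S" and q: "q \<in> poly_ring K V"
    and idem: "pvar v * (pvar v - 1) \<in> ideal_gen (poly_ring K V) X"
  shows "coord_prod S * (1 - q * pvar v) - coord_prod S \<in> ideal_gen (poly_ring K V) X"
proof -
  have split: "coord_prod S = (pvar v - 1) * coord_prod (S - {v})"
    unfolding coord_prod_def using S by (simp add: prod.remove)
  have "coord_prod S * (1 - q * pvar v) - coord_prod S =
      - ((q * coord_prod (S - {v})) * (pvar v * (pvar v - 1)))"
    unfolding split by (simp add: algebra_simps)
  moreover have "(q * coord_prod (S - {v})) * (pvar v * (pvar v - 1)) \<in> ideal_gen (poly_ring K V) X"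
    using S by (intro ideal_gen_mult[OF K idem] poly_ring_mult[OF K q] coord_prod_in_ring[OF K]) auto
  ultimately show ?thesis
    using ideal_gen_uminus[OF K] by simp
qed

text \<open>The factor of \<open>b\<^sub>g\<^sub>h\<^sub>,\<^sub>M\<close> contributed by a cell of \<open>T\<^sub>g\<^sub>h\<close> is \<open>v - 1\<close>, where \<open>v\<close> is the following
  variable.\<close>

definition viz_choice :: "nat \<Rightarrow> nat \<Rightarrow> nat \<Rightarrow> nat \<Rightarrow> (nat \<times> nat) set \<Rightarrow> nat \<times> nat \<Rightarrow> viz_var" where
  "viz_choice nG nH g h M = (\<lambda>(a, b). if (a, b) \<in> U_set nG nH g h - M
     then (if a = g then EdgeH {h, b} else EdgeG {g, a}) else Vert a b)"

definition viz_supp :: "nat \<Rightarrow> nat \<Rightarrow> nat \<Rightarrow> nat \<Rightarrow> (nat \<times> nat) set \<Rightarrow> viz_var set" where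
  "viz_supp nG nH g h M = viz_choice nG nH g h M ` T_set nG nH g h"

text \<open>The singletons make the linear basis elements \<open>e - 1\<close> instances of
  \<open>coord_prod\<close>, and at the same time remove the idempotent relations of these edges
  from \<open>antichain_basis\<close>.\<close>

definition viz_family :: "nat \<Rightarrow> nat \<Rightarrow> viz_var set set" where
  "viz_family nG nH =
     {{EdgeG {1, g}} | g. g \<in> {1..nG} - {1}} \<union>
     {{EdgeH {1, h}} | h. h \<in> {1..nH} - {1}} \<union>
     {viz_supp nG nH g h M | g h M. g \<in> {1..nG} \<and> h \<in> {1..nH} \<and> M \<subseteq> U_set nG nH g h}"

lemma viz_familyI:
  "g \<in> {1..nG} - {1} \<Longrightarrow> {EdgeG {1, g}} \<in> viz_family nG nH"
  "h \<in> {1..nH} - {1} \<Longrightarrow> {EdgeH {1, h}} \<in> viz_family nG nH"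
  "g \<in> {1..nG} \<Longrightarrow> h \<in> {1..nH} \<Longrightarrow> M \<subseteq> U_set nG nH g h \<Longrightarrow> viz_supp nG nH g h M \<in> viz_family nG nH"
  unfolding viz_family_def by blast+

lemma viz_familyE:
  assumes "S \<in> viz_family nG nH"
  obtains g where "g \<in> {1..nG} - {1}" "S = {EdgeG {1, g}}"
    | h where "h \<in> {1..nH} - {1}" "S = {EdgeH {1, h}}"
    | g h M where "g \<in> {1..nG}" "h \<in> {1..nH}" "M \<subseteq> U_set nG nH g h" "S = viz_supp nG nH g h M"
  using assms unfolding viz_family_def Un_iff mem_Collect_eq by blast

section \<open>Combinatorics of the cells and their supports\<close>

lemma finite_T_set: "finite (T_set nG nH g h)"
  by (rule finite_subset[of _ "{1..nG} \<times> {1..nH}"]) (auto simp: T_set_def)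

lemma card_T_set:
  assumes "g \<in> {1..nG}" "h \<in> {1..nH}"
  shows "card (T_set nG nH g h) = nG + nH - 1"
proof -
  have "T_set nG nH g h = ({g} \<times> {1..nH}) \<union> (({1..nG} - {g}) \<times> {h})"
    using assms by (auto simp: T_set_def)
  moreover have "card (({g} \<times> {1..nH}) \<union> (({1..nG} - {g}) \<times> {h})) = nH + (nG - 1)"
    using assms by (subst card_Un_disjoint) (auto simp: card_cartesian_product)
  ultimately show ?thesis
    using assms by simp
qed

lemma U_set_subset: "g \<in> {1..nG} \<Longrightarrow> h \<in> {1..nH} \<Longrightarrow> U_set nG nH g h \<subseteq> T_set nG nH g h"
  by (auto simp: U_set_def Ur_set_def Uc_set_def T_set_def split: if_splits)

text \<open>Row cells can only yield \<open>EdgeH\<close> and column cells only \<open>EdgeG\<close>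
  besides their own \<open>Vert\<close>, and \<open>{h, b}\<close> with fixed \<open>h\<close>
  determines \<open>b\<close>.\<close>

lemma inj_on_viz_choice: "inj_on (viz_choice nG nH g h M) (T_set nG nH g h)"
  by (rule inj_onI)
    (auto simp: viz_choice_def U_set_def Ur_set_def Uc_set_def T_set_def doubleton_eq_iff
      split: if_splits)

lemma finite_viz_supp: "finite (viz_supp nG nH g h M)"
  by (simp add: viz_supp_def finite_T_set)

lemma card_viz_supp:
  "g \<in> {1..nG} \<Longrightarrow> h \<in> {1..nH} \<Longrightarrow> card (viz_supp nG nH g h M) = nG + nH - 1"
  unfolding viz_supp_def by (simp only: card_image[OF inj_on_viz_choice] card_T_set)

lemma viz_varsI:
  "g \<in> {1..nG} \<Longrightarrow> g' \<in> {1..nG} \<Longrightarrow> g \<noteq> g' \<Longrightarrow> EdgeG {g, g'} \<in> viz_vars nG nH"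
  "h \<in> {1..nH} \<Longrightarrow> h' \<in> {1..nH} \<Longrightarrow> h \<noteq> h' \<Longrightarrow> EdgeH {h, h'} \<in> viz_vars nG nH"
  "g \<in> {1..nG} \<Longrightarrow> h \<in> {1..nH} \<Longrightarrow> Vert g h \<in> viz_vars nG nH"
  unfolding viz_vars_def by blast+

lemma viz_supp_subset:
  assumes "g \<in> {1..nG}" "h \<in> {1..nH}"
  shows "viz_supp nG nH g h M \<subseteq> viz_vars nG nH"
proof -
  have "viz_choice nG nH g h M (a, b) \<in> viz_vars nG nH" if "(a, b) \<in> T_set nG nH g h" for a b
  proof -
    have "a \<in> {1..nG}" "b \<in> {1..nH}"
      using that by (auto simp: T_set_def)
    moreover have "a = g \<and> b \<noteq> h \<or> b = h \<and> a \<noteq> g" if "(a, b) \<in> U_set nG nH g h"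
      using that by (auto simp: U_set_def Ur_set_def Uc_set_def split: if_splits)
    ultimately show ?thesis
      using assms by (auto simp: viz_choice_def intro!: viz_varsI)
  qed
  then show ?thesis
    by (auto simp: viz_supp_def)
qed

text \<open>An edge is chosen only at a cell of \<open>U_set\<close>, where both of its endpoints
  differ from 1.\<close>

lemma dominating_edges_notin_viz_supp:
  "EdgeG {1, a} \<notin> viz_supp nG nH g h M" "EdgeH {1, b} \<notin> viz_supp nG nH g h M"
  by (auto simp: viz_supp_def viz_choice_def U_set_def Ur_set_def Uc_set_def T_set_def
      doubleton_eq_iff split: if_splits)

lemma finite_viz_vars: "finite (viz_vars nG nH)"
proof (rule finite_subset)
  show "viz_vars nG nH \<subseteq> EdgeG ` Pow {1..nG} \<union> EdgeH ` Pow {1..nH} \<union>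
      (\<lambda>(g, h). Vert g h) ` ({1..nG} \<times> {1..nH})"
    by (auto simp: viz_vars_def)
qed auto

text \<open>\<open>T_set\<close> is the disjoint union of the three index sets, and each bracketed
  factor collapses to \<open>x - 1\<close> on \<open>M\<close> and to \<open>e - 1\<close> off
  \<open>M\<close>.\<close>

lemma b_poly_eq_coord_prod:
  assumes gh: "g \<in> {1..nG}" "h \<in> {1..nH}"
  shows "b_poly nG nH g h M = coord_prod (viz_supp nG nH g h M)"
proof -
  let ?c = "\<lambda>p. pvar (viz_choice nG nH g h M p) - 1"
  let ?Ur = "Ur_set nH g h" and ?Uc = "Uc_set nG g h" and ?Ub = "Ubar_set nG nH g h"
  have T: "T_set nG nH g h = ?Ub \<union> ?Ur \<union> ?Uc"
    using U_set_subset[OF gh] by (auto simp: Ubar_set_def U_set_def)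
  have fin: "finite ?Ub" "finite ?Ur" "finite ?Uc"
    using finite_T_set[of nG nH g h] unfolding T by auto
  have "coord_prod (viz_supp nG nH g h M) = prod ?c (T_set nG nH g h)"
    unfolding coord_prod_def viz_supp_def by (simp add: prod.reindex[OF inj_on_viz_choice])
  also have "\<dots> = prod ?c ?Ub * prod ?c ?Ur * prod ?c ?Uc"
    unfolding T using fin
    by (subst prod.union_disjoint; (subst prod.union_disjoint)?)
      (auto simp: Ubar_set_def U_set_def Ur_set_def Uc_set_def split: if_splits)
  also have "prod ?c ?Ub = (\<Prod>(g', h')\<in>?Ub. xv g' h' - 1)"
    by (intro prod.cong refl) (auto simp: viz_choice_def Ubar_set_def xv_def)
  also have "prod ?c ?Ur = (\<Prod>(_, h')\<in>?Ur.
        of_bool ((g, h') \<in> M) * (xv g h' - eH h h') + eH h h' - 1)"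
    by (intro prod.cong refl)
      (auto simp: viz_choice_def U_set_def xv_def eH_def Ur_set_def split: if_splits)
  also have "prod ?c ?Uc = (\<Prod>(g', _)\<in>?Uc.
        of_bool ((g', h) \<in> M) * (xv g' h - eG g g') + eG g g' - 1)"
    by (intro prod.cong refl)
      (auto simp: viz_choice_def U_set_def xv_def eG_def Uc_set_def split: if_splits)
  finally show ?thesis
    by (simp add: b_poly_def)
qed

text \<open>A support has \<open>nG + nH - 1\<close> elements, which is at least 2 unless
  \<open>nG = nH = 1\<close>; in that case \<open>{Vert 1 1}\<close> is a support.\<close>

lemma singleton_in_viz_family:
  assumes "nG \<ge> 1" "nH \<ge> 1" "\<not> (nG = 1 \<and> nH = 1)"
  shows "{v} \<in> viz_family nG nH \<longleftrightarrow>
    (\<exists>g\<in>{1..nG} - {1}. v = EdgeG {1, g}) \<or> (\<exists>h\<in>{1..nH} - {1}. v = EdgeH {1, h})"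
proof -
  have "{v} \<noteq> viz_supp nG nH g h M" if "g \<in> {1..nG}" "h \<in> {1..nH}" for g h M
  proof
    assume "{v} = viz_supp nG nH g h M"
    then have "card {v} = nG + nH - 1"
      using card_viz_supp[OF that] by simp
    then show False
      using assms by simp presburger
  qed
  then show ?thesis
    unfolding viz_family_def by blast
qed

text \<open>The edges at vertex 1 are exactly the variables whose idempotent relation is dropped on
  both sides.\<close>

lemma viz_basis_eq:
  assumes n: "nG \<ge> 1" "nH \<ge> 1" "\<not> (nG = 1 \<and> nH = 1)"
  shows "viz_basis nG nH = antichain_basis (viz_vars nG nH) (viz_family nG nH)"
proof -
  have sing: "coord_prod {v} = pvar v - 1" for v :: viz_var
    by (simp add: coord_prod_def)
  have "{b_poly nG nH g h M | g h M. g \<in> {1..nG} \<and> h \<in> {1..nH} \<and> M \<subseteq> U_set nG nH g h} =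
      {coord_prod (viz_supp nG nH g h M) | g h M.
        g \<in> {1..nG} \<and> h \<in> {1..nH} \<and> M \<subseteq> U_set nG nH g h}"
    using b_poly_eq_coord_prod by (intro Collect_cong) metis
  also have "\<dots> = coord_prod ` {viz_supp nG nH g h M | g h M.
        g \<in> {1..nG} \<and> h \<in> {1..nH} \<and> M \<subseteq> U_set nG nH g h}"
    by blast
  moreover have "{eG 1 g - 1 | g. g \<in> {1..nG} - {1}} =
      coord_prod ` {{EdgeG {1, g}} | g. g \<in> {1..nG} - {1}}"
    unfolding setcompr_eq_image image_image sing eG_def by simp
  moreover have "{eH 1 h - 1 | h. h \<in> {1..nH} - {1}} =
      coord_prod ` {{EdgeH {1, h}} | h. h \<in> {1..nH} - {1}}"
    unfolding setcompr_eq_image image_image sing eH_def by simp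
  ultimately have "coord_prod ` viz_family nG nH =
      {eG 1 g - 1 | g. g \<in> {1..nG} - {1}} \<union> {eH 1 h - 1 | h. h \<in> {1..nH} - {1}} \<union>
      {b_poly nG nH g h M | g h M. g \<in> {1..nG} \<and> h \<in> {1..nH} \<and> M \<subseteq> U_set nG nH g h}"
    unfolding viz_family_def image_Un by (simp only:)
  moreover have "{pvar v * (pvar v - 1) | v. v \<in> viz_vars nG nH \<and> {v} \<notin> viz_family nG nH} =
     {eG g g' * (eG g g' - 1) | g g'. g \<in> {1..nG} - {1} \<and> g' \<in> {1..nG} - {1} \<and> g \<noteq> g'} \<union>
     {eH h h' * (eH h h' - 1) | h h'. h \<in> {1..nH} - {1} \<and> h' \<in> {1..nH} - {1} \<and> h \<noteq> h'} \<union>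
     {xv g h * (xv g h - 1) | g h. g \<in> {1..nG} \<and> h \<in> {1..nH}}" (is "?A = ?B")
  proof -
    have "{v \<in> viz_vars nG nH. {v} \<notin> viz_family nG nH} =
       {EdgeG {g, g'} | g g'. g \<in> {1..nG} - {1} \<and> g' \<in> {1..nG} - {1} \<and> g \<noteq> g'} \<union>
       {EdgeH {h, h'} | h h'. h \<in> {1..nH} - {1} \<and> h' \<in> {1..nH} - {1} \<and> h \<noteq> h'} \<union>
       {Vert g h | g h. g \<in> {1..nG} \<and> h \<in> {1..nH}}" (is "?L = ?M")
      unfolding singleton_in_viz_family[OF n] viz_vars_def
      by (intro subset_antisym subsetI; elim UnE CollectE exE conjE) (force simp: doubleton_eq_iff)+
    moreover have "?A = (\<lambda>v. pvar v * (pvar v - 1)) ` ?L"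
      by blast
    moreover have "?B = (\<lambda>v. pvar v * (pvar v - 1)) ` ?M"
      unfolding eG_def eH_def xv_def by blast
    ultimately show ?thesis
      by simp
  qed
  ultimately show ?thesis
    unfolding viz_basis_def antichain_basis_def by (simp only: Un_ac)
qed

text \<open>All supports have the same size, and the edge in a singleton member lies in no support;
  so an inclusion is between sets of equal size.\<close>

lemma viz_family_antichain:
  assumes n: "nG \<ge> 1" "nH \<ge> 1" "\<not> (nG = 1 \<and> nH = 1)"
    and S: "S \<in> viz_family nG nH" "S' \<in> viz_family nG nH" "S \<subseteq> S'"
  shows "S = S'"
proof -
  have fin: "finite S'"
    using S(2) finite_viz_supp by (auto simp: viz_family_def)
  have "card S' \<le> card S"
  proof (cases "\<exists>v. S = {v}")
    case True
    then obtain v where v: "S = {v}"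
      by blast
    then have "(\<exists>g. v = EdgeG {1, g}) \<or> (\<exists>h. v = EdgeH {1, h})"
      using S(1) singleton_in_viz_family[OF n] by blast
    then have "v \<notin> viz_supp nG nH g h M" for g h M
      using dominating_edges_notin_viz_supp by blast
    then show ?thesis
      using S v unfolding viz_family_def by auto
  next
    case False
    then have "card S = nG + nH - 1"
      using S(1) card_viz_supp unfolding viz_family_def by blast
    moreover have "card S' \<le> nG + nH - 1"
      using S(2) card_viz_supp n unfolding viz_family_def by fastforce
    ultimately show ?thesis
      by simp
  qed
  then show ?thesis
    using S(3) fin by (simp add: card_seteq)
qed

lemma viz_family_subset: "viz_family nG nH \<subseteq> Pow (viz_vars nG nH)"
proof
  fix S assume "S \<in> viz_family nG nH"
  then show "S \<in> Pow (viz_vars nG nH)"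
  proof (cases rule: viz_familyE)
    case (1 g)
    then show ?thesis using viz_varsI(1)[of 1 nG g nH] by auto
  next
    case (2 h)
    then show ?thesis using viz_varsI(2)[of 1 nH h nG] by auto
  next
    case (3 g h M)
    then show ?thesis using viz_supp_subset[of g nG h nH M] by simp
  qed
qed

lemma empty_notin_viz_family:
  assumes "nG \<ge> 1" "nH \<ge> 1"
  shows "{} \<notin> viz_family nG nH"
proof -
  have "viz_supp nG nH g h M \<noteq> {}" if "g \<in> {1..nG}" "h \<in> {1..nH}" for g h M
    using card_viz_supp[OF that, of M] assms by auto
  then show ?thesis
    unfolding viz_family_def by blast
qed

section \<open>The generators and their zero-one zeros\<close>

lemma viz_gens_subset:
  assumes K: "real_subfield K"
  shows "viz_gens nG nH \<subseteq> poly_ring K (viz_vars nG nH)"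
proof -
  note ring = poly_ring_diff[OF K] poly_ring_mult[OF K] poly_ring_one[OF K] poly_ring_prod[OF K]
  have "eG g g' \<in> poly_ring K (viz_vars nG nH)" if "g \<in> {1..nG}" "g' \<in> {1..nG}" "g \<noteq> g'" for g g'
    unfolding eG_def using that by (intro poly_ring_pvar[OF K]) (auto intro: viz_varsI)
  moreover have "eH h h' \<in> poly_ring K (viz_vars nG nH)"
    if "h \<in> {1..nH}" "h' \<in> {1..nH}" "h \<noteq> h'" for h h'
    unfolding eH_def using that by (intro poly_ring_pvar[OF K]) (auto intro: viz_varsI)
  moreover have "xv g h \<in> poly_ring K (viz_vars nG nH)" if "g \<in> {1..nG}" "h \<in> {1..nH}" for g h
    unfolding xv_def using that by (auto intro!: poly_ring_pvar[OF K] viz_varsI)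
  ultimately show ?thesis
    unfolding viz_gens_def by (auto intro!: ring)
qed

text \<open>Only the domination generators need an argument: if one is nonzero at the point of
  \<open>A\<close>, then \<open>A\<close> contains a whole support, against the assumption on
  \<open>A\<close>.\<close>

lemma eval01_viz_gens:
  assumes A: "\<forall>S\<in>viz_family nG nH. \<not> S \<subseteq> A" and f: "f \<in> viz_gens nG nH"
  shows "eval01 A f = 0"
proof -
  have G1: "EdgeG {1, g} \<notin> A" if "g \<in> {1..nG} - {1}" for g
    using A viz_familyI(1)[OF that] by blast
  have H1: "EdgeH {1, h} \<notin> A" if "h \<in> {1..nH} - {1}" for h
    using A viz_familyI(2)[OF that] by blast
  have idem: "eval01 A (pvar v * (pvar v - 1)) = 0" for v
    by (simp add: eval01_mult eval01_diff)
  have dom: "eval01 A ((1 - xv g h) * (\<Prod>g'\<in>{1..nG} - {g}. 1 - eG g g' * xv g' h)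
      * (\<Prod>h'\<in>{1..nH} - {h}. 1 - eH h h' * xv g h')) = 0"
    if gh: "g \<in> {1..nG}" "h \<in> {1..nH}" for g h
  proof (rule ccontr)
    assume "\<not> ?thesis"
    then have x: "Vert g h \<in> A"
      and eg: "\<And>g'. g' \<in> {1..nG} \<Longrightarrow> g' \<noteq> g \<Longrightarrow> EdgeG {g, g'} \<in> A \<or> Vert g' h \<in> A"
      and eh: "\<And>h'. h' \<in> {1..nH} \<Longrightarrow> h' \<noteq> h \<Longrightarrow> EdgeH {h, h'} \<in> A \<or> Vert g h' \<in> A"
      by (auto simp: eval01_mult eval01_diff eval01_prod xv_def eG_def eH_def
          simp flip: of_bool_conj)
    \<comment> \<open>At each cell of \<open>U_set\<close> the vertex or the edge variable lies in
      \<open>A\<close>; \<open>M\<close> makes the support pick the vertex variable whenever it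
      does.\<close>
    define M where "M = {(a, b) \<in> U_set nG nH g h. Vert a b \<in> A}"
    have "viz_choice nG nH g h M (a, b) \<in> A" if ab: "(a, b) \<in> T_set nG nH g h" for a b
    proof (cases "(a, b) \<in> U_set nG nH g h")
      case True
      then show ?thesis
        using eg[of a] eh[of b]
        by (auto simp: viz_choice_def M_def U_set_def Ur_set_def Uc_set_def split: if_splits)
    next
      case False
      have "Vert a b \<in> A"
      proof -
        consider "a = g" "b = h" | "a = g" "b \<noteq> h" "b \<in> {1..nH}" "b = 1 \<or> h = 1"
          | "b = h" "a \<noteq> g" "a \<in> {1..nG}" "a = 1 \<or> g = 1"
          using ab False by (auto simp: T_set_def U_set_def Ur_set_def Uc_set_def split: if_splits)
        then show ?thesis
        proof cases
          case 1
          then show ?thesis using x by simp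
        next
          case 2
          \<comment> \<open>One endpoint is 1, so this edge coordinate is 1 and the vertex variable
            must be the one in \<open>A\<close>.\<close>
          then have "EdgeH {h, b} \<notin> A"
            using H1[of b] H1[of h] gh by (auto simp: insert_commute)
          then show ?thesis using eh[of b] 2 by simp
        next
          case 3
          then have "EdgeG {g, a} \<notin> A"
            using G1[of a] G1[of g] gh by (auto simp: insert_commute)
          then show ?thesis using eg[of a] 3 by simp
        qed
      qed
      then show ?thesis
        using False by (simp add: viz_choice_def)
    qed
    then have "viz_supp nG nH g h M \<subseteq> A"
      by (auto simp: viz_supp_def)
    moreover have "viz_supp nG nH g h M \<in> viz_family nG nH"
      using gh by (intro viz_familyI) (auto simp: M_def)
    ultimately show False
      using A by blast
  qed
  have e1: "eval01 A (1 - pvar (EdgeG {g, 1})) = 0" if "g \<in> {1..nG} - {1}" for g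
    using G1[OF that] by (simp add: eval01_diff insert_commute)
  have e2: "eval01 A (1 - pvar (EdgeH {h, 1})) = 0" if "h \<in> {1..nH} - {1}" for h
    using H1[OF that] by (simp add: eval01_diff insert_commute)
  consider v where "f = pvar v * (pvar v - 1)"
    | g where "g \<in> {1..nG} - {1}" "f = 1 - pvar (EdgeG {g, 1})"
    | h where "h \<in> {1..nH} - {1}" "f = 1 - pvar (EdgeH {h, 1})"
    | g h where "g \<in> {1..nG}" "h \<in> {1..nH}"
      "f = (1 - xv g h) * (\<Prod>g'\<in>{1..nG} - {g}. 1 - eG g g' * xv g' h)
      * (\<Prod>h'\<in>{1..nH} - {h}. 1 - eH h h' * xv g h')"
    using f unfolding viz_gens_def Un_iff mem_Collect_eq
    by (elim disjE) (auto simp: eG_def eH_def xv_def)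
  then show ?thesis
    using idem e1 e2 dom by cases auto
qed

section \<open>Membership of the basis in the ideal\<close>

lemma viz_idempotent_gen:
  "v \<in> viz_vars nG nH \<Longrightarrow> pvar v * (pvar v - 1) \<in> viz_gens nG nH"
  unfolding viz_vars_def viz_gens_def eG_def eH_def xv_def by blast

text \<open>Every factor of the domination generator at \<open>(g, h)\<close> contains a variable of
  the support, namely the one chosen at the corresponding cell, and is therefore absorbed.\<close>

lemma coord_prod_viz_supp_in_ideal:
  assumes K: "real_subfield K" and gh: "g \<in> {1..nG}" "h \<in> {1..nH}"
  shows "coord_prod (viz_supp nG nH g h M) \<in>
    ideal_gen (poly_ring K (viz_vars nG nH)) (viz_gens nG nH)"
proof -
  let ?V = "viz_vars nG nH" and ?S = "viz_supp nG nH g h M"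
  let ?R = "poly_ring K ?V"
  let ?I = "ideal_gen ?R (viz_gens nG nH)"
  let ?b = "coord_prod ?S"
  let ?fG = "\<lambda>g'. 1 - eG g g' * xv g' h" and ?fH = "\<lambda>h'. 1 - eH h h' * xv g h'"
  let ?D = "(1 - xv g h) * (\<Prod>g'\<in>{1..nG} - {g}. ?fG g') * (\<Prod>h'\<in>{1..nH} - {h}. ?fH h')"
  have S: "finite ?S" "?S \<subseteq> ?V"
    using finite_viz_supp viz_supp_subset[OF gh] by auto
  have b: "?b \<in> ?R"
    by (rule coord_prod_in_ring[OF K S(2)])
  have absorb: "?b * (1 - q * pvar v) - ?b \<in> ?I" if "v \<in> ?S" "q \<in> ?R" for v q
    using that S ideal_gen_superset[OF K] viz_idempotent_gen
    by (intro coord_prod_absorb[OF K]) blast+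
  have x: "xv a b \<in> ?R" if "a \<in> {1..nG}" "b \<in> {1..nH}" for a b
    unfolding xv_def using that by (auto intro!: poly_ring_pvar[OF K] viz_varsI)
  have eG: "eG g g' \<in> ?R" if "g' \<in> {1..nG} - {g}" for g'
    unfolding eG_def using that gh by (auto intro!: poly_ring_pvar[OF K] viz_varsI)
  have eH: "eH h h' \<in> ?R" if "h' \<in> {1..nH} - {h}" for h'
    unfolding eH_def using that gh by (auto intro!: poly_ring_pvar[OF K] viz_varsI)
  have choice: "viz_choice nG nH g h M p \<in> ?S" if "p \<in> T_set nG nH g h" for p
    using that by (simp add: viz_supp_def)
  have absG: "?b * ?fG g' - ?b \<in> ?I" if g': "g' \<in> {1..nG} - {g}" for g'
  proof -
    have "EdgeG {g, g'} \<in> ?S \<or> Vert g' h \<in> ?S"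
      using choice[of "(g', h)"] g' gh by (auto simp: T_set_def viz_choice_def split: if_splits)
    then show ?thesis
    proof
      \<comment> \<open>The edge is the absorbed variable and the vertex variable its cofactor; in
        the other case the roles are exchanged.\<close>
      assume "EdgeG {g, g'} \<in> ?S"
      from absorb[OF this x[of g' h]] show ?thesis
        using g' gh by (simp add: eG_def mult.commute)
    next
      assume "Vert g' h \<in> ?S"
      from absorb[OF this eG[OF g']] show ?thesis
        by (simp add: xv_def)
    qed
  qed
  have absH: "?b * ?fH h' - ?b \<in> ?I" if h': "h' \<in> {1..nH} - {h}" for h'
  proof -
    have "EdgeH {h, h'} \<in> ?S \<or> Vert g h' \<in> ?S"
      using choice[of "(g, h')"] h' gh by (auto simp: T_set_def viz_choice_def split: if_splits)
    then show ?thesis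
    proof
      assume "EdgeH {h, h'} \<in> ?S"
      from absorb[OF this x[of g h']] show ?thesis
        using h' gh by (simp add: eH_def mult.commute)
    next
      assume "Vert g h' \<in> ?S"
      from absorb[OF this eH[OF h']] show ?thesis
        by (simp add: xv_def)
    qed
  qed
  have "Vert g h \<in> ?S"
    using choice[of "(g, h)"] gh
    by (auto simp: T_set_def viz_choice_def U_set_def Ur_set_def Uc_set_def split: if_splits)
  from absorb[OF this poly_ring_one[OF K]] have abs1: "?b * (1 - xv g h) - ?b \<in> ?I"
    by (simp add: xv_def)
  \<comment> \<open>The three blocks of the generator form one indexed family, so the absorption
    lemma applies once more.\<close>
  let ?f = "\<lambda>i :: nat. if i = 0 then 1 - xv g h
    else if i = 1 then (\<Prod>g'\<in>{1..nG} - {g}. ?fG g') else (\<Prod>h'\<in>{1..nH} - {h}. ?fH h')"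
  note ring = poly_ring_diff[OF K] poly_ring_mult[OF K] poly_ring_one[OF K] poly_ring_prod[OF K]
  have "?b * prod ?f {0, 1, 2} - ?b \<in> ?I"
  proof (rule prod_absorb_mod_ideal[OF K b])
    fix i :: nat
    show "?f i \<in> ?R"
      using gh by (auto intro!: ring x eG eH)
    have "?b * (\<Prod>g'\<in>{1..nG} - {g}. ?fG g') - ?b \<in> ?I"
      by (rule prod_absorb_mod_ideal[OF K b]) (use gh absG in \<open>auto intro!: ring x eG\<close>)
    moreover have "?b * (\<Prod>h'\<in>{1..nH} - {h}. ?fH h') - ?b \<in> ?I"
      by (rule prod_absorb_mod_ideal[OF K b]) (use gh absH in \<open>auto intro!: ring x eH\<close>)
    ultimately show "?b * ?f i - ?b \<in> ?I"
      using abs1 by simp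
  qed
  then have "?b * ?D - ?b \<in> ?I"
    by (simp add: mult.assoc)
  moreover have "?b * ?D \<in> ?I"
    using gh unfolding viz_gens_def by (intro ideal_gen_base[OF K _ b]) blast
  ultimately have "?b * ?D - (?b * ?D - ?b) \<in> ?I"
    using ideal_gen_diff[OF K] by blast
  then show ?thesis
    by simp
qed

lemma viz_antichain_basis_subset_ideal:
  assumes K: "real_subfield K"
  shows "antichain_basis (viz_vars nG nH) (viz_family nG nH) \<subseteq>
    ideal_gen (poly_ring K (viz_vars nG nH)) (viz_gens nG nH)" (is "_ \<subseteq> ?I")
proof -
  have gen: "f \<in> ?I" if "f \<in> viz_gens nG nH" for f
    using ideal_gen_superset[OF K] that by blast
  have edgeG: "coord_prod {EdgeG {1, g}} \<in> ?I" if "g \<in> {1..nG} - {1}" for g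
  proof -
    \<comment> \<open>The generator differs from the basis element by its sign and by the order of
      the endpoints.\<close>
    have "1 - eG g 1 \<in> ?I"
      using that by (intro gen) (unfold viz_gens_def, blast)
    from ideal_gen_uminus[OF K this] show ?thesis
      by (simp add: coord_prod_def eG_def insert_commute)
  qed
  have edgeH: "coord_prod {EdgeH {1, h}} \<in> ?I" if "h \<in> {1..nH} - {1}" for h
  proof -
    have "1 - eH h 1 \<in> ?I"
      using that by (intro gen) (unfold viz_gens_def, blast)
    from ideal_gen_uminus[OF K this] show ?thesis
      by (simp add: coord_prod_def eH_def insert_commute)
  qed
  have "coord_prod S \<in> ?I" if "S \<in> viz_family nG nH" for S
    using that
    by (rule viz_familyE) (simp_all only: edgeG edgeH coord_prod_viz_supp_in_ideal[OF K])
  moreover have "pvar v * (pvar v - 1) \<in> ?I" if "v \<in> viz_vars nG nH" for v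
    using gen viz_idempotent_gen[OF that] .
  ultimately show ?thesis
    unfolding antichain_basis_def by (intro Un_least subsetI; elim CollectE imageE exE conjE) simp_all
qed

text \<open>The antichain is \<open>viz_family\<close> and the generating set
  \<open>viz_gens\<close>. For \<open>nG = nH = 1\<close> the basis would contain both
  \<open>x - 1\<close> and \<open>x * (x - 1)\<close>, hence the exclusion.\<close>

theorem theorem3p12:
  fixes K :: "real set" and nG nH :: nat and r :: "viz_var rel"
  assumes "real_subfield K"
    and "nG \<ge> 1" and "nH \<ge> 1"
    and "\<not> (nG = 1 \<and> nH = 1)"
    and "linear_order_on (viz_vars nG nH) r"
  shows "is_reduced_groebner_basis (deglex r) (viz_ring K nG nH) (viz_ideal K nG nH)
           (viz_basis nG nH)"
  unfolding viz_ring_def viz_ideal_def viz_basis_eq[OF assms(2-4)]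
  using finite_viz_vars viz_family_subset empty_notin_viz_family[OF assms(2,3)]
    viz_family_antichain[OF assms(2-4)] viz_gens_subset[OF assms(1)] eval01_viz_gens
    viz_antichain_basis_subset_ideal[OF assms(1)]
  by (intro antichain_reduced_groebner_basis[OF assms(1,5)])

end
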